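(* Let $\mathcal{B}_1,\mathcal{B}_2$ be boolean $\mathcal{C}$-algebras. The following statements hold: (1) for any finite system $\mathcal{S}$ one has $\mathrm{Rad}_{\mathcal{B}_1}(\mathcal{S})=\mathrm{Rad}_{\mathcal{B}_2}(\mathcal{S})$; (2) $\mathrm{qvar}(\mathcal{B}_1)=\mathrm{qvar}(\mathcal{B}_2)$; (3) if $\mathcal{B}_1,\mathcal{B}_2$ are weakly equationally Noetherian, then they are geometrically equivalent; (4) if $\mathcal{B}_1,\mathcal{B}_2$ are $\mathrm{q}_\omega$-compact, then they are geometrically equivalent.
   Context: Language. Let $\mathcal{L}=\{\vee,\cdot,\bar{\ },0,1\}\cup\{\mathbf{c}_i\mid i\in I\}$ be the language of boolean algebras (disjunction, conjunction, negation, $0$, $1$) extended by an arbitrary (possibly infinite) set of constant symbols. A boolean $\mathcal{C}$-algebra is a boolean algebra $\mathcal{B}$ regarded as a structure of the language $\mathcal{L}$, where $\mathcal{C}\subseteq\mathcal{B}$ denotes the boolean subalgebra generated by (the interpretations of) the constants $\mathbf{c}_i$, $i\in I$. Standing assumption: $\mathcal{B}_1$ and $\mathcal{B}_2$ have the same subalgebra $\mathcal{C}$ generated by the constants of $\mathcal{L}$; i.e. the subalgebras generated by the constants in $\mathcal{B}_1$ and $\mathcal{B}_2$ are isomorphic as $\mathcal{L}$-structures (the isomorphism sends the interpretation of each $\mathbf{c}_i$ to the interpretation of $\mathbf{c}_i$) and are identified. Equations. For a finite set of variables $X=\{x_1,\dots,x_n\}$, an equation is an atomic formula $\tau(X)=\sigma(X)$,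 where $\tau,\sigma$ are $\mathcal{L}$-terms in $X$. A system is an arbitrary (possibly infinite) set of equations in a common finite set of variables. $V_{\mathcal{B}}(\mathcal{S})\subseteq\mathcal{B}^n$ denotes the solution set of $\mathcal{S}$ in $\mathcal{B}$. Two systems in variables $X$ are equivalent over $\mathcal{B}$ if they have the same solution set over $\mathcal{B}$. Radical and geometric equivalence. The radical $\mathrm{Rad}_{\mathcal{B}}(\mathcal{S})$ of a system $\mathcal{S}$ in variables $X$ is the set of all equations $\tau(X)=\sigma(X)$ such that $V_{\mathcal{B}}(\mathcal{S})\subseteq V_{\mathcal{B}}(\tau(X)=\sigma(X))$. $\mathcal{B}_1,\mathcal{B}_2$ are geometrically equivalent if $\mathrm{Rad}_{\mathcal{B}_1}(\mathcal{S})=\mathrm{Rad}_{\mathcal{B}_2}(\mathcal{S})$ for every system $\mathcal{S}$. Quasivariety. A quasi-identity is an $\mathcal{L}$-formula $\forall x_1\dots\forall x_n\,\bigl(\tau_1(X)=\sigma_1(X)\wedge\dots\wedge\tau_m(X)=\sigma_m(X)\to\tau(X)=\sigma(X)\bigr)$ with $\tau_i,\sigma_i,\tau,\sigma$ terms of $\mathcal{L}$. $\mathrm{qvar}(\mathcal{B})$ is the class of all boolean algebras of the language $\mathcal{L}$ that satisfy every quasi-identity true in $\mathcal{B}$. Weakly equationally Noetherian. $\mathcal{B}$ is weakly equationally Noetherian if for every system $\mathcal{S}$ there exists a finite system $\mathcal{S}'$ (in the same variables, not necessarily a subsystem of $\mathcal{S}$) equivalent to $\mathcal{S}$ over $\mathcal{B}$.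 $\mathrm{q}_\omega$-compactness. $\mathcal{B}$ is $\mathrm{q}_\omega$-compact if for any system $\mathcal{S}$ and any equation $\tau(X)=\sigma(X)$ with $V_{\mathcal{B}}(\mathcal{S})\subseteq V_{\mathcal{B}}(\tau(X)=\sigma(X))$ there exists a finite subsystem $\mathcal{S}'\subseteq\mathcal{S}$ with $V_{\mathcal{B}}(\mathcal{S}')\subseteq V_{\mathcal{B}}(\tau(X)=\sigma(X))$. *)

theory Defs
  imports Main "HOL-Library.FuncSet"
begin

section \<open>Boolean algebras with constants as first-order structures\<close>

text \<open>The universe of a structure is the whole type \<open>'a\<close>. The constant symbols are
  the elements of a set \<open>I :: 'i set\<close>, which may be empty or infinite; the values
  of \<open>const\<close> outside \<open>I\<close> play no role.\<close>

record ('i, 'a) L_structure =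
  meet :: "'a \<Rightarrow> 'a \<Rightarrow> 'a"
  join :: "'a \<Rightarrow> 'a \<Rightarrow> 'a"
  neg :: "'a \<Rightarrow> 'a"
  bottom :: 'a
  top_elem :: 'a
  const :: "'i \<Rightarrow> 'a"

definition boolean_L_algebra :: "('i, 'a) L_structure \<Rightarrow> bool" where
  "boolean_L_algebra B \<longleftrightarrow>
     abstract_boolean_algebra (meet B) (join B) (neg B) (bottom B) (top_elem B)"

inductive_set const_subalgebra :: "'i set \<Rightarrow> ('i, 'a) L_structure \<Rightarrow> 'a set"
  for I :: "'i set" and B :: "('i, 'a) L_structure" where
  const: "i \<in> I \<Longrightarrow> const B i \<in> const_subalgebra I B"
| bottom: "bottom B \<in> const_subalgebra I B"
| top: "top_elem B \<in> const_subalgebra I B"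
| neg: "x \<in> const_subalgebra I B \<Longrightarrow> neg B x \<in> const_subalgebra I B"
| meet: "x \<in> const_subalgebra I B \<Longrightarrow> y \<in> const_subalgebra I B
    \<Longrightarrow> meet B x y \<in> const_subalgebra I B"
| join: "x \<in> const_subalgebra I B \<Longrightarrow> y \<in> const_subalgebra I B
    \<Longrightarrow> join B x y \<in> const_subalgebra I B"

text \<open>Two structures have the same subalgebra \<open>\<C>\<close> generated by the constants when the
  two generated subalgebras are isomorphic as structures of the language with constants.\<close>

definition same_const_subalgebra ::
    "'i set \<Rightarrow> ('i, 'a) L_structure \<Rightarrow> ('i, 'b) L_structure \<Rightarrow> bool" where
  "same_const_subalgebra I B1 B2 \<longleftrightarrow>
     (\<exists>f. bij_betw f (const_subalgebra I B1) (const_subalgebra I B2) \<and>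
        f (bottom B1) = bottom B2 \<and>
        f (top_elem B1) = top_elem B2 \<and>
        (\<forall>i\<in>I. f (const B1 i) = const B2 i) \<and>
        (\<forall>x\<in>const_subalgebra I B1. f (neg B1 x) = neg B2 (f x)) \<and>
        (\<forall>x\<in>const_subalgebra I B1. \<forall>y\<in>const_subalgebra I B1.
           f (meet B1 x y) = meet B2 (f x) (f y) \<and>
           f (join B1 x y) = join B2 (f x) (f y)))"


section \<open>Terms, equations and systems\<close>

datatype (constants: 'i) L_term =
    Var nat
  | Const 'i
  | Zero
  | One
  | Neg "'i L_term"
  | Meet "'i L_term" "'i L_term"
  | Join "'i L_term" "'i L_term"

primrec vars :: "'i L_term \<Rightarrow> nat set" where
  "vars (Var k) = {k}"
| "vars (Const i) = {}"
| "vars Zero = {}"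
| "vars One = {}"
| "vars (Neg t) = vars t"
| "vars (Meet s t) = vars s \<union> vars t"
| "vars (Join s t) = vars s \<union> vars t"

primrec eval :: "('i, 'a) L_structure \<Rightarrow> (nat \<Rightarrow> 'a) \<Rightarrow> 'i L_term \<Rightarrow> 'a" where
  "eval B p (Var k) = p k"
| "eval B p (Const i) = const B i"
| "eval B p Zero = bottom B"
| "eval B p One = top_elem B"
| "eval B p (Neg t) = neg B (eval B p t)"
| "eval B p (Meet s t) = meet B (eval B p s) (eval B p t)"
| "eval B p (Join s t) = join B (eval B p s) (eval B p t)"

text \<open>An equation \<open>\<tau>(X) = \<sigma>(X)\<close> is the pair \<open>(\<tau>, \<sigma>)\<close>. The variables
  \<open>x\<^sub>1, \<dots>, x\<^sub>n\<close> are \<open>Var 0, \<dots>, Var (n - 1)\<close>.\<close>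

type_synonym 'i L_equation = "'i L_term \<times> 'i L_term"

definition equations :: "'i set \<Rightarrow> nat \<Rightarrow> 'i L_equation set" where
  "equations I n =
     {(t, s). vars t \<subseteq> {..<n} \<and> vars s \<subseteq> {..<n} \<and> constants t \<subseteq> I \<and> constants s \<subseteq> I}"

definition is_system :: "'i set \<Rightarrow> nat \<Rightarrow> 'i L_equation set \<Rightarrow> bool" where
  "is_system I n S \<longleftrightarrow> S \<subseteq> equations I n"

text \<open>Points of \<open>\<B>\<^sup>n\<close> are the extensional functions on \<open>{..<n}\<close>.\<close>

definition solutions :: "nat \<Rightarrow> ('i, 'a) L_structure \<Rightarrow> 'i L_equation set \<Rightarrow> (nat \<Rightarrow> 'a) set" where
  "solutions n B S =
     {p \<in> {..<n} \<rightarrow>\<^sub>E UNIV. \<forall>(t, s)\<in>S. eval B p t = eval B p s}"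

definition Rad ::
    "'i set \<Rightarrow> nat \<Rightarrow> ('i, 'a) L_structure \<Rightarrow> 'i L_equation set \<Rightarrow> 'i L_equation set" where
  "Rad I n B S = {e \<in> equations I n. solutions n B S \<subseteq> solutions n B {e}}"

definition geometrically_equivalent ::
    "'i set \<Rightarrow> ('i, 'a) L_structure \<Rightarrow> ('i, 'b) L_structure \<Rightarrow> bool" where
  "geometrically_equivalent I B1 B2 \<longleftrightarrow>
     (\<forall>n S. is_system I n S \<longrightarrow> Rad I n B1 S = Rad I n B2 S)"

definition weakly_equationally_Noetherian :: "'i set \<Rightarrow> ('i, 'a) L_structure \<Rightarrow> bool" where
  "weakly_equationally_Noetherian I B \<longleftrightarrow>
     (\<forall>n S. is_system I n S \<longrightarrow>
        (\<exists>S'. is_system I n S' \<and> finite S' \<and> solutions n B S' = solutions n B S))"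

definition q_omega_compact :: "'i set \<Rightarrow> ('i, 'a) L_structure \<Rightarrow> bool" where
  "q_omega_compact I B \<longleftrightarrow>
     (\<forall>n S. \<forall>e\<in>equations I n. is_system I n S \<longrightarrow> solutions n B S \<subseteq> solutions n B {e} \<longrightarrow>
        (\<exists>S'\<subseteq>S. finite S' \<and> solutions n B S' \<subseteq> solutions n B {e}))"


section \<open>Quasi-identities and quasivarieties\<close>

text \<open>The pair \<open>(es, e)\<close> of a list of premises and a conclusion, all in the variables
  \<open>x\<^sub>1, \<dots>, x\<^sub>n\<close>, stands for the universal
  closure of the implication from the conjunction of \<open>es\<close> to \<open>e\<close>.\<close>

type_synonym 'i quasi_identity = "'i L_equation list \<times> 'i L_equation"

definition quasi_identities :: "'i set \<Rightarrow> nat \<Rightarrow> 'i quasi_identity set" where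
  "quasi_identities I n = {(es, e). set es \<subseteq> equations I n \<and> e \<in> equations I n}"

fun satisfies_quasi_identity ::
    "nat \<Rightarrow> ('i, 'a) L_structure \<Rightarrow> 'i quasi_identity \<Rightarrow> bool" where
  "satisfies_quasi_identity n B (es, (t, s)) \<longleftrightarrow>
     (\<forall>p \<in> {..<n} \<rightarrow>\<^sub>E UNIV.
        (\<forall>(t', s')\<in>set es. eval B p t' = eval B p s') \<longrightarrow> eval B p t = eval B p s)"

text \<open>A class of structures is rendered by its members with universe \<open>'c\<close>, for an
  arbitrary type \<open>'c\<close> unrelated to the universe of \<open>B\<close>.\<close>

definition qvar :: "'i set \<Rightarrow> ('i, 'a) L_structure \<Rightarrow> ('i, 'c) L_structure set" where
  "qvar I B =
     {A. boolean_L_algebra A \<and>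
         (\<forall>n. \<forall>q\<in>quasi_identities I n.
            satisfies_quasi_identity n B q \<longrightarrow> satisfies_quasi_identity n A q)}"

end

theory Submission
  imports Defs
begin

text \<open>The point is that a quasi-identity fails in \<open>\<B>\<close> only if it fails in \<open>\<C>\<close>. Finitely many equations
  amount to one equation \<open>t = 0\<close>, so a counterexample is a point with \<open>t = 0\<close> and \<open>u \<noteq> 0\<close>. By
  Shannon expansion in the last variable \<open>x\<close>, \<open>t = 0\<close> means \<open>t(0) \<le> x \<le> \<not> t(1)\<close>, and \<open>u\<close> remains
  nonzero when \<open>x\<close> is moved to one of these two bounds, both of which are terms in the other
  variables. Eliminating all variables in this way leaves a condition on closed terms, which
  depends on \<open>\<C>\<close> alone. Hence \<open>\<B>\<^sub>1\<close> and \<open>\<B>\<^sub>2\<close> satisfy the same quasi-identities, and the other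
  claims are formal consequences.\<close>

section \<open>Boolean algebra below an element and below its complement\<close>

context abstract_boolean_algebra
begin

text \<open>Shannon expansion in germ: \<open>z\<close> is the join of its parts below
  \<open>y\<close> and below the complement of \<open>y\<close>.\<close>

lemma eq_zero_split: "z = \<^bold>0 \<longleftrightarrow> y \<^bold>\<sqinter> z = \<^bold>0 \<and> \<^bold>- y \<^bold>\<sqinter> z = \<^bold>0"
proof -
  have "z = (y \<^bold>\<squnion> \<^bold>- y) \<^bold>\<sqinter> z"
    by (simp add: conj.commute conj_one_right)
  also have "\<dots> = (y \<^bold>\<sqinter> z) \<^bold>\<squnion> (\<^bold>- y \<^bold>\<sqinter> z)"
    by (rule conj_disj_distrib2)
  finally show ?thesis
    by (metis conj_zero_right disj_zero_right)
qed

lemma disj_eq_zero_iff: "x \<^bold>\<squnion> y = \<^bold>0 \<longleftrightarrow> x = \<^bold>0 \<and> y = \<^bold>0"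
  by (metis disj.left_idem disj.commute disj_zero_right)

text \<open>The part below \<open>y\<close> of a complement depends only on the part below
  \<open>y\<close> of the element, so agreement below \<open>y\<close> respects complements.\<close>

lemma conj_compl_cong:
  assumes "y \<^bold>\<sqinter> a = y \<^bold>\<sqinter> b"
  shows "y \<^bold>\<sqinter> \<^bold>- a = y \<^bold>\<sqinter> \<^bold>- b"
proof -
  have "y \<^bold>\<sqinter> \<^bold>- c = y \<^bold>\<sqinter> \<^bold>- (y \<^bold>\<sqinter> c)" for c
    by (simp add: conj_disj_distrib disj.commute disj_zero_right)
  then show ?thesis
    using assms by metis
qed

lemma conj_conj_cong:
  assumes "y \<^bold>\<sqinter> a = y \<^bold>\<sqinter> a'" "y \<^bold>\<sqinter> b = y \<^bold>\<sqinter> b'"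
  shows "y \<^bold>\<sqinter> (a \<^bold>\<sqinter> b) = y \<^bold>\<sqinter> (a' \<^bold>\<sqinter> b')"
  by (metis assms conj.assoc conj.left_commute)

lemma conj_eq_self_if:
  assumes "x \<^bold>\<sqinter> a = \<^bold>0"
  shows "x \<^bold>\<sqinter> \<^bold>- a = x"
  by (metis assms conj_disj_distrib conj_one_right disj.commute disj_cancel_right disj_zero_right)

text \<open>Resolution on \<open>x\<close>: \<open>a\<close> lies below the complement of
  \<open>x\<close>, and \<open>b\<close> lies below \<open>x\<close>.\<close>

lemma conj_eq_zero_if:
  assumes "x \<^bold>\<sqinter> a = \<^bold>0" "\<^bold>- x \<^bold>\<sqinter> b = \<^bold>0"
  shows "a \<^bold>\<sqinter> b = \<^bold>0"
  unfolding eq_zero_split[of "a \<^bold>\<sqinter> b" x]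
  by (metis assms conj.assoc conj.left_commute conj_zero_left conj_zero_right)

text \<open>Since \<open>x\<close> lies below the complement of \<open>a\<close>, a nonzero meet
  with \<open>x\<close> survives when \<open>x\<close> is enlarged to that complement.\<close>

lemma compl_conj_neq_zero:
  assumes "x \<^bold>\<sqinter> a = \<^bold>0" "x \<^bold>\<sqinter> c \<noteq> \<^bold>0"
  shows "\<^bold>- a \<^bold>\<sqinter> c \<noteq> \<^bold>0"
  by (metis assms conj.assoc conj_zero_right conj_eq_self_if)

lemma sym_diff_eq_zero_iff:
  "(x \<^bold>\<sqinter> \<^bold>- y) \<^bold>\<squnion> (y \<^bold>\<sqinter> \<^bold>- x) = \<^bold>0 \<longleftrightarrow> x = y"
proof
  assume "(x \<^bold>\<sqinter> \<^bold>- y) \<^bold>\<squnion> (y \<^bold>\<sqinter> \<^bold>- x) = \<^bold>0"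
  then have "x \<^bold>\<sqinter> \<^bold>- y = \<^bold>0" "y \<^bold>\<sqinter> \<^bold>- x = \<^bold>0"
    by (simp_all add: disj_eq_zero_iff)
  then show "x = y"
    by (metis conj.commute conj_eq_self_if double_compl)
qed (simp add: disj_zero_right)

end

lemma boolean_L_algebraD:
  "boolean_L_algebra B \<Longrightarrow> abstract_boolean_algebra (meet B) (join B) (neg B) (bottom B) (top_elem B)"
  by (simp add: boolean_L_algebra_def)


section \<open>Substitution and systems as single terms\<close>

lemma eval_cong: "(\<And>k. k \<in> vars t \<Longrightarrow> p k = q k) \<Longrightarrow> eval B p t = eval B q t"
  by (induction t) auto

primrec subst :: "nat \<Rightarrow> 'i L_term \<Rightarrow> 'i L_term \<Rightarrow> 'i L_term" where
  "subst k r (Var j) = (if j = k then r else Var j)"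
| "subst k r (Const i) = Const i"
| "subst k r Zero = Zero"
| "subst k r One = One"
| "subst k r (Neg t) = Neg (subst k r t)"
| "subst k r (Meet s t) = Meet (subst k r s) (subst k r t)"
| "subst k r (Join s t) = Join (subst k r s) (subst k r t)"

lemma eval_subst: "eval B p (subst k r t) = eval B (p(k := eval B p r)) t"
  by (induction t) auto

lemma vars_subst: "vars (subst k r t) \<subseteq> (vars t - {k}) \<union> vars r"
  by (induction t) auto

lemma constants_subst: "constants (subst k r t) \<subseteq> constants t \<union> constants r"
  by (induction t) auto

text \<open>Every operation preserves agreement below \<open>y\<close>, hence so does evaluation;
  Shannon expansion of terms rests on this.\<close>

lemma meet_eval_cong:
  assumes "boolean_L_algebra B" "meet B y a = meet B y b"
  shows "meet B y (eval B (p(k := a)) t) = meet B y (eval B (p(k := b)) t)"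
proof -
  interpret abstract_boolean_algebra "meet B" "join B" "neg B" "bottom B" "top_elem B"
    using assms(1) by (rule boolean_L_algebraD)
  show ?thesis
    using assms(2)
    by (induction t) (auto intro: conj_compl_cong conj_conj_cong simp: conj_disj_distrib)
qed

text \<open>A join of symmetric differences vanishes exactly when all of them do, so one term codes
  the whole list.\<close>

primrec system_term :: "'i L_equation list \<Rightarrow> 'i L_term" where
  "system_term [] = Zero"
| "system_term (e # es) =
     Join (Join (Meet (fst e) (Neg (snd e))) (Meet (snd e) (Neg (fst e)))) (system_term es)"

lemma eval_system_term_eq_bottom_iff:
  assumes "boolean_L_algebra B"
  shows "eval B p (system_term es) = bottom B \<longleftrightarrow> (\<forall>(t, s)\<in>set es. eval B p t = eval B p s)"
proof -
  interpret abstract_boolean_algebra "meet B" "join B" "neg B" "bottom B" "top_elem B"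
    using assms by (rule boolean_L_algebraD)
  show ?thesis
  proof (induction es)
    case (Cons e es)
    show ?case
      by (simp only: system_term.simps eval.simps sym_diff_eq_zero_iff Cons.IH
          disj_eq_zero_iff[of _ "eval B p (system_term es)"]) auto
  qed simp
qed

lemma system_term_vars_constants:
  assumes "set es \<subseteq> equations I n"
  shows "vars (system_term es) \<subseteq> {..<n}" "constants (system_term es) \<subseteq> I"
  using assms by (induction es) (auto simp: equations_def)


section \<open>Elimination of variables\<close>

lemma eval_closed_term:
  assumes "f (bottom B1) = bottom B2" "f (top_elem B1) = top_elem B2"
    and "\<forall>i\<in>I. f (const B1 i) = const B2 i"
    and "\<forall>x\<in>const_subalgebra I B1. f (neg B1 x) = neg B2 (f x)"
    and "\<forall>x\<in>const_subalgebra I B1. \<forall>y\<in>const_subalgebra I B1.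
           f (meet B1 x y) = meet B2 (f x) (f y) \<and> f (join B1 x y) = join B2 (f x) (f y)"
    and "vars t = {}" "constants t \<subseteq> I"
  shows "eval B1 p t \<in> const_subalgebra I B1 \<and> f (eval B1 p t) = eval B2 q t"
  using assms(6,7)
  by (induction t) (auto simp: assms(1-5) intro: const_subalgebra.intros)

text \<open>The trace of the isomorphism that elimination works with; unlike a map it is visibly
  symmetric. The assignments \<open>p\<close> and \<open>q\<close> are independent because closed
  terms ignore them.\<close>

definition same_closed_zeros ::
    "'i set \<Rightarrow> ('i, 'a) L_structure \<Rightarrow> ('i, 'b) L_structure \<Rightarrow> bool" where
  "same_closed_zeros I B1 B2 \<longleftrightarrow>
     (\<forall>t p q. vars t = {} \<longrightarrow> constants t \<subseteq> I \<longrightarrow>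
        (eval B1 p t = bottom B1 \<longleftrightarrow> eval B2 q t = bottom B2))"

lemma same_closed_zeros_sym: "same_closed_zeros I B1 B2 \<Longrightarrow> same_closed_zeros I B2 B1"
  unfolding same_closed_zeros_def by blast

lemma same_closed_zeros_if_same_const_subalgebra:
  assumes "same_const_subalgebra I B1 B2"
  shows "same_closed_zeros I B1 B2"
proof -
  obtain f where bij: "bij_betw f (const_subalgebra I B1) (const_subalgebra I B2)"
    and f: "f (bottom B1) = bottom B2" "f (top_elem B1) = top_elem B2"
      "\<forall>i\<in>I. f (const B1 i) = const B2 i"
      "\<forall>x\<in>const_subalgebra I B1. f (neg B1 x) = neg B2 (f x)"
      "\<forall>x\<in>const_subalgebra I B1. \<forall>y\<in>const_subalgebra I B1.
         f (meet B1 x y) = meet B2 (f x) (f y) \<and> f (join B1 x y) = join B2 (f x) (f y)"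
    using assms unfolding same_const_subalgebra_def by blast
  show ?thesis
    unfolding same_closed_zeros_def
  proof (intro allI impI)
    fix t p q
    assume "vars t = {}" "constants t \<subseteq> I"
    then have t: "eval B1 p t \<in> const_subalgebra I B1" "f (eval B1 p t) = eval B2 q t"
      using eval_closed_term[OF f] by blast+
    have "eval B1 p t = bottom B1 \<longleftrightarrow> f (eval B1 p t) = f (bottom B1)"
      using inj_on_eq_iff[OF bij_betw_imp_inj_on[OF bij] t(1) const_subalgebra.bottom] by simp
    then show "eval B1 p t = bottom B1 \<longleftrightarrow> eval B2 q t = bottom B2"
      by (simp add: t(2) f(1))
  qed
qed

text \<open>The last variable is replaced by a term \<open>r\<close> in the others, evaluated at the
  same \<open>p\<close>, so the point of the counterexample never changes during
  elimination.\<close>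

lemma eliminate_variable:
  assumes B: "boolean_L_algebra B"
    and vars: "vars t \<subseteq> {..<Suc n}" "vars u \<subseteq> {..<Suc n}"
    and constants: "constants t \<subseteq> I" "constants u \<subseteq> I"
    and t: "eval B p t = bottom B" and u: "eval B p u \<noteq> bottom B"
  shows "\<exists>r. vars r \<subseteq> {..<n} \<and> constants r \<subseteq> I \<and>
    eval B p (subst n r t) = bottom B \<and> eval B p (subst n r u) \<noteq> bottom B"
proof -
  interpret abstract_boolean_algebra "meet B" "join B" "neg B" "bottom B" "top_elem B"
    using B by (rule boolean_L_algebraD)
  let ?x = "p n" and ?one = "p(n := top_elem B)" and ?zero = "p(n := bottom B)"
  let ?t1 = "eval B ?one t" and ?t0 = "eval B ?zero t"
  let ?u1 = "eval B ?one u" and ?u0 = "eval B ?zero u"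
  \<comment> \<open>Below \<open>y\<close> the element \<open>y\<close> agrees with
    \<open>1\<close>, and below its complement with \<open>0\<close>.\<close>
  have at_one: "meet B y (eval B (p(n := y)) s) = meet B y (eval B ?one s)" for y s
    by (rule meet_eval_cong[OF B]) (simp add: conj_one_right)
  have at_zero: "meet B (neg B y) (eval B (p(n := y)) s) = meet B (neg B y) (eval B ?zero s)"
    for y s
    by (rule meet_eval_cong[OF B]) simp
  have expand: "eval B (p(n := y)) s = bottom B \<longleftrightarrow>
      meet B y (eval B ?one s) = bottom B \<and> meet B (neg B y) (eval B ?zero s) = bottom B" for y s
    by (subst eq_zero_split[of _ y]) (simp only: at_one at_zero)
  have t10: "meet B ?x ?t1 = bottom B" "meet B (neg B ?x) ?t0 = bottom B"
    using expand[of ?x t] t by simp_all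
  \<comment> \<open>This disjointness makes both bounds, the complement of \<open>?t1\<close> and
    \<open>?t0\<close> itself, roots of \<open>t\<close>.\<close>
  have meet_t: "meet B ?t1 ?t0 = bottom B"
    by (rule conj_eq_zero_if[OF t10])
  define r where "r = subst n One t"
  define r' where "r' = subst n Zero t"
  have r: "vars r \<subseteq> {..<n}" "constants r \<subseteq> I" "eval B p r = ?t1"
    using vars constants vars_subst[of n One t] constants_subst[of n One t]
    by (force simp: r_def eval_subst less_Suc_eq)+
  have r': "vars r' \<subseteq> {..<n}" "constants r' \<subseteq> I" "eval B p r' = ?t0"
    using vars constants vars_subst[of n Zero t] constants_subst[of n Zero t]
    by (force simp: r'_def eval_subst less_Suc_eq)+
  consider "meet B ?x ?u1 \<noteq> bottom B" | "meet B (neg B ?x) ?u0 \<noteq> bottom B"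
    using expand[of ?x u] u by auto
  then show ?thesis
  proof cases
    \<comment> \<open>Here \<open>u\<close> has a nonzero part below \<open>?x\<close>, so
      \<open>?x\<close> is raised to its upper bound, the complement of \<open>?t1\<close>.\<close>
    case 1
    have "meet B (neg B ?t1) ?u1 \<noteq> bottom B"
      by (rule compl_conj_neq_zero[OF t10(1) 1])
    then show ?thesis
      using r meet_t by (intro exI[of _ "Neg r"]) (simp add: eval_subst expand)
  next
    \<comment> \<open>Dually, \<open>?x\<close> is lowered to \<open>?t0\<close>, which enlarges its
      complement.\<close>
    case 2
    have "meet B (neg B ?t0) ?u0 \<noteq> bottom B"
      by (rule compl_conj_neq_zero[OF t10(2) 2])
    then show ?thesis
      using r' meet_t by (intro exI[of _ r']) (simp add: eval_subst expand conj.commute)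
  qed
qed

text \<open>Elimination takes place in \<open>B1\<close>, the resulting closed terms transfer, and
  the point is rebuilt in \<open>B2\<close> one coordinate at a time.\<close>

lemma transfer_counterexample:
  assumes "boolean_L_algebra B1" "same_closed_zeros I B1 B2"
    and "vars t \<subseteq> {..<n}" "vars u \<subseteq> {..<n}" "constants t \<subseteq> I" "constants u \<subseteq> I"
    and "eval B1 p t = bottom B1" "eval B1 p u \<noteq> bottom B1"
  shows "\<exists>q. eval B2 q t = bottom B2 \<and> eval B2 q u \<noteq> bottom B2"
  using assms(3-)
proof (induction n arbitrary: t u)
  case 0
  then show ?case
    using assms(2) unfolding same_closed_zeros_def by (metis lessThan_0 subset_empty)
next
  case (Suc n)
  obtain r where r: "vars r \<subseteq> {..<n}" "constants r \<subseteq> I"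
    "eval B1 p (subst n r t) = bottom B1" "eval B1 p (subst n r u) \<noteq> bottom B1"
    using eliminate_variable[OF assms(1) Suc.prems] by blast
  have "vars (subst n r s) \<subseteq> {..<n}" "constants (subst n r s) \<subseteq> I"
    if "vars s \<subseteq> {..<Suc n}" "constants s \<subseteq> I" for s
    using that r(1,2) vars_subst[of n r s] constants_subst[of n r s]
    by (force simp: less_Suc_eq)+
  then obtain q where "eval B2 q (subst n r t) = bottom B2" "eval B2 q (subst n r u) \<noteq> bottom B2"
    using Suc.IH[of "subst n r t" "subst n r u"] Suc.prems r(3,4) by blast
  \<comment> \<open>The witness is \<open>q\<close> with coordinate \<open>n\<close> reset to the
    value of \<open>r\<close>.\<close>
  then show ?case
    by (auto simp: eval_subst)
qed


section \<open>Quasi-identities and radicals\<close>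

lemma eval_restrict: "vars t \<subseteq> {..<n} \<Longrightarrow> eval B (restrict p {..<n}) t = eval B p t"
  by (rule eval_cong) auto

lemma satisfies_quasi_identity_transfer:
  assumes B: "boolean_L_algebra B1" "boolean_L_algebra B2" and same: "same_closed_zeros I B1 B2"
    and q: "q \<in> quasi_identities I n" and sat: "satisfies_quasi_identity n B2 q"
  shows "satisfies_quasi_identity n B1 q"
proof -
  obtain es t s where q_eq: "q = (es, (t, s))"
    by (metis surj_pair)
  \<comment> \<open>The conclusion becomes a one-element list so that \<open>system_term\<close>
    codes it like the premises.\<close>
  have es: "set es \<subseteq> equations I n" and ts: "set [(t, s)] \<subseteq> equations I n"
    using q by (auto simp: q_eq quasi_identities_def)
  show ?thesis
    unfolding q_eq satisfies_quasi_identity.simps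
  proof (intro ballI impI, rule ccontr)
    fix p
    assume "\<forall>(t', s')\<in>set es. eval B1 p t' = eval B1 p s'" "eval B1 p t \<noteq> eval B1 p s"
    then have "eval B1 p (system_term es) = bottom B1"
      "eval B1 p (system_term [(t, s)]) \<noteq> bottom B1"
      using B(1) by (simp_all only: eval_system_term_eq_bottom_iff) auto
    then obtain q where "eval B2 q (system_term es) = bottom B2"
      "eval B2 q (system_term [(t, s)]) \<noteq> bottom B2"
      using transfer_counterexample[OF B(1) same system_term_vars_constants(1)[OF es]
          system_term_vars_constants(1)[OF ts] system_term_vars_constants(2)[OF es]
          system_term_vars_constants(2)[OF ts]] by blast
    then have holds: "\<forall>(t', s')\<in>set es. eval B2 q t' = eval B2 q s'"
      and fails: "eval B2 q t \<noteq> eval B2 q s"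
      using B(2) by (simp_all only: eval_system_term_eq_bottom_iff) auto
    \<comment> \<open>Quasi-identities range over extensional points, whereas \<open>q\<close> is an
      arbitrary assignment.\<close>
    let ?q = "restrict q {..<n}"
    have restrict: "eval B2 ?q t' = eval B2 q t' \<and> eval B2 ?q s' = eval B2 q s'"
      if "(t', s') \<in> equations I n" for t' s'
      using that by (simp add: equations_def eval_restrict)
    have "\<forall>(t', s')\<in>set es. eval B2 ?q t' = eval B2 ?q s'"
    proof clarify
      fix t' s'
      assume "(t', s') \<in> set es"
      then have "(t', s') \<in> equations I n" "eval B2 q t' = eval B2 q s'"
        using es holds by auto
      then show "eval B2 ?q t' = eval B2 ?q s'"
        by (simp only: restrict)
    qed
    then have "eval B2 ?q t = eval B2 ?q s"
      using sat by (auto simp: q_eq)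
    then show False
      using fails restrict[of t s] ts by auto
  qed
qed

text \<open>This link carries the transfer of quasi-identities over to radicals of finite
  systems.\<close>

lemma in_Rad_set_iff:
  "e \<in> Rad I n B (set es) \<longleftrightarrow> e \<in> equations I n \<and> satisfies_quasi_identity n B (es, e)"
  by (cases e) (auto simp: Rad_def solutions_def)

lemma Rad_finite_subset:
  assumes "boolean_L_algebra B1" "boolean_L_algebra B2" "same_closed_zeros I B1 B2"
    and "is_system I n S" "finite S"
  shows "Rad I n B2 S \<subseteq> Rad I n B1 S"
proof -
  obtain es where "S = set es"
    using finite_list[OF assms(5)] by blast
  then show ?thesis
    using satisfies_quasi_identity_transfer[OF assms(1-3), of _ n] assms(4)
    by (auto simp: in_Rad_set_iff quasi_identities_def is_system_def)
qed

lemma qvar_subset: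
  assumes "boolean_L_algebra B1" "boolean_L_algebra B2" "same_closed_zeros I B1 B2"
  shows "qvar I B1 \<subseteq> qvar I B2"
  using satisfies_quasi_identity_transfer[OF assms] unfolding qvar_def by blast

section \<open>Radicals and the two finiteness conditions\<close>

lemma Rad_cong: "solutions n B S = solutions n B S' \<Longrightarrow> Rad I n B S = Rad I n B S'"
  by (simp add: Rad_def)

lemma Rad_antimono: "solutions n B S \<subseteq> solutions n B S' \<Longrightarrow> Rad I n B S' \<subseteq> Rad I n B S"
  unfolding Rad_def by blast

lemma subset_Rad: "is_system I n S \<Longrightarrow> S \<subseteq> Rad I n B S"
  by (auto simp: Rad_def solutions_def is_system_def)

lemma solutions_subset_if_subset_Rad: "S \<subseteq> Rad I n B S' \<Longrightarrow> solutions n B S' \<subseteq> solutions n B S"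
proof
  fix p
  assume S: "S \<subseteq> Rad I n B S'" and p: "p \<in> solutions n B S'"
  have "eval B p t = eval B p s" if "(t, s) \<in> S" for t s
  proof -
    have "solutions n B S' \<subseteq> solutions n B {(t, s)}"
      using S that by (auto simp: Rad_def)
    then have "p \<in> solutions n B {(t, s)}"
      using p by (rule subsetD)
    then show ?thesis
      by (simp add: solutions_def)
  qed
  then show "p \<in> solutions n B S"
    using p by (auto simp: solutions_def)
qed

text \<open>A finite \<open>S'\<close> equivalent to \<open>S\<close> over \<open>B2\<close> has the
  same radical in both algebras. That radical contains \<open>S\<close>, so over \<open>B1\<close>
  passing from \<open>S\<close> to \<open>S'\<close> can only shrink the solution set and enlarge
  the radical.\<close>

lemma Rad_subset_if_weakly_equationally_Noetherian:
  assumes "weakly_equationally_Noetherian I B2"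
    and fin: "\<And>n S. is_system I n S \<Longrightarrow> finite S \<Longrightarrow> Rad I n B1 S = Rad I n B2 S"
    and S: "is_system I n S"
  shows "Rad I n B1 S \<subseteq> Rad I n B2 S"
proof -
  obtain S' where S': "is_system I n S'" "finite S'" "solutions n B2 S' = solutions n B2 S"
    using assms(1) S unfolding weakly_equationally_Noetherian_def by blast
  have Rad_S': "Rad I n B1 S' = Rad I n B2 S"
    using fin[OF S'(1,2)] Rad_cong[OF S'(3)] by metis
  then have "S \<subseteq> Rad I n B1 S'"
    using subset_Rad[OF S] by metis
  then have "Rad I n B1 S \<subseteq> Rad I n B1 S'"
    by (intro Rad_antimono solutions_subset_if_subset_Rad)
  then show ?thesis
    by (simp add: Rad_S')
qed

text \<open>If \<open>e\<close> follows from \<open>S\<close> in \<open>B1\<close>, it follows there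
  from a finite part of \<open>S\<close>, hence in \<open>B2\<close> from the same part, hence from
  all of \<open>S\<close>.\<close>

lemma Rad_subset_if_q_omega_compact:
  assumes "q_omega_compact I B1"
    and fin: "\<And>n S. is_system I n S \<Longrightarrow> finite S \<Longrightarrow> Rad I n B1 S = Rad I n B2 S"
    and S: "is_system I n S"
  shows "Rad I n B1 S \<subseteq> Rad I n B2 S"
proof
  fix e
  assume "e \<in> Rad I n B1 S"
  then have e: "e \<in> equations I n" "solutions n B1 S \<subseteq> solutions n B1 {e}"
    unfolding Rad_def by blast+
  then obtain S' where S': "S' \<subseteq> S" "finite S'" "solutions n B1 S' \<subseteq> solutions n B1 {e}"
    using assms(1) S unfolding q_omega_compact_def by meson
  have "is_system I n S'"
    using S S'(1) by (auto simp: is_system_def)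
  then have "e \<in> Rad I n B2 S'"
    using e(1) S'(3) fin[OF _ S'(2)] unfolding Rad_def by blast
  moreover have "solutions n B2 S \<subseteq> solutions n B2 S'"
    using S'(1) by (auto simp: solutions_def)
  ultimately show "e \<in> Rad I n B2 S"
    using Rad_antimono[of n B2 S S' I] by blast
qed

theorem theorem7p3:
  fixes I :: "'i set"
    and B1 :: "('i, 'a) L_structure"
    and B2 :: "('i, 'b) L_structure"
  assumes "boolean_L_algebra B1"
    and "boolean_L_algebra B2"
    and "same_const_subalgebra I B1 B2"
  shows "(\<forall>n S. is_system I n S \<and> finite S \<longrightarrow> Rad I n B1 S = Rad I n B2 S) \<and>
    (qvar I B1 :: ('i, 'c) L_structure set) = qvar I B2 \<and>
    (weakly_equationally_Noetherian I B1 \<and> weakly_equationally_Noetherian I B2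
      \<longrightarrow> geometrically_equivalent I B1 B2) \<and>
    (q_omega_compact I B1 \<and> q_omega_compact I B2
      \<longrightarrow> geometrically_equivalent I B1 B2)"
proof -
  note B = assms(1,2)
  have same: "same_closed_zeros I B1 B2"
    using assms(3) by (rule same_closed_zeros_if_same_const_subalgebra)
  note same' = same_closed_zeros_sym[OF same]
  have fin: "Rad I n B1 S = Rad I n B2 S" if "is_system I n S" "finite S" for n S
    using Rad_finite_subset[OF B same that] Rad_finite_subset[OF B(2,1) same' that] by blast
  have "(qvar I B1 :: ('i, 'c) L_structure set) = qvar I B2"
    using qvar_subset[OF B same] qvar_subset[OF B(2,1) same'] by blast
  moreover have "geometrically_equivalent I B1 B2"
    if "weakly_equationally_Noetherian I B1" "weakly_equationally_Noetherian I B2"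
    unfolding geometrically_equivalent_def
  proof (intro allI impI equalityI)
    fix n S
    assume S: "is_system I n S"
    show "Rad I n B1 S \<subseteq> Rad I n B2 S"
      by (rule Rad_subset_if_weakly_equationally_Noetherian[OF that(2) fin S])
    \<comment> \<open>With the algebras exchanged, \<open>B1\<close> supplies the finite equivalent
      system.\<close>
    show "Rad I n B2 S \<subseteq> Rad I n B1 S"
      by (rule Rad_subset_if_weakly_equationally_Noetherian[OF that(1) fin[symmetric] S])
  qed
  moreover have "geometrically_equivalent I B1 B2"
    if "q_omega_compact I B1" "q_omega_compact I B2"
    unfolding geometrically_equivalent_def
  proof (intro allI impI equalityI)
    fix n S
    assume S: "is_system I n S"
    show "Rad I n B1 S \<subseteq> Rad I n B2 S"
      by (rule Rad_subset_if_q_omega_compact[OF that(1) fin S])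
    show "Rad I n B2 S \<subseteq> Rad I n B1 S"
      by (rule Rad_subset_if_q_omega_compact[OF that(2) fin[symmetric] S])
  qed
  ultimately show ?thesis
    using fin by blast
qed

end
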